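(* Let $k(i)=\binom{n-1}{i}+\binom{n-1}{n-i}$ and let $\Theta=(\theta_1,\dots,\theta_n):\mathbb D\to\mathbb C^n$ be a $\mathbf{\Theta}_n$-inner function. Then, for each $1\le i\le n-1$, $$\left(\frac{\theta_i}{k(i)},\frac{\theta_{n-i}}{k(i)},\theta_n^p\right)$$ is an $\mathbb E$-inner function.
   Context: $\mathbb D$ is the open unit disc, $\mathbb T$ the unit circle. Fix positive integers $m,p$ with $p$ dividing $m$, and $n\ge2$. Let $s_i$ be the $i$-th elementary symmetric polynomial in $n$ variables. Define $\theta:\mathbb C^n\to\mathbb C^n$ by $\theta(z)=\big(s_1(z_1^m,\dots,z_n^m),\dots,s_{n-1}(z_1^m,\dots,z_n^m),(z_1\cdots z_n)^{m/p}\big)$, and set $\mathbf{\Theta}_n=\theta(\mathbb D^n)$, $\overline{\mathbf{\Theta}}_n=\theta(\overline{\mathbb D}^n)$. The tetrablock is $\mathbb E=\{(x_1,x_2,x_3)\in\mathbb C^3:1-zx_1-wx_2+zwx_3\ne0\text{ for all }|z|\le1,|w|\le1\}$ and $\overline{\mathbb E}$ is its closure. The distinguished boundaries $b\mathbf{\Theta}_n$ and $b\mathbb E$ are the Shilov boundaries of $\overline{\mathbf{\Theta}}_n$ and $\overline{\mathbb E}$, i.e. the smallest closed subsets on which every function continuous on the compact set and holomorphic in its interior attains its maximum modulus (known: $b\mathbf{\Theta}_n=\theta(\mathbb T^n)$ and $b\mathbb E=\{x\in\mathbb C^3:x_1=\overline{x_2}x_3,\ |x_2|\le1,\ |x_3|=1\}$).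 A $\mathbf{\Theta}_n$-inner (respectively $\mathbb E$-inner) function is a holomorphic map $\mathbb D\to\overline{\mathbf{\Theta}}_n$ (respectively $\mathbb D\to\overline{\mathbb E}$) whose radial limits belong to $b\mathbf{\Theta}_n$ (respectively $b\mathbb E$) at Lebesgue-a.e. point of $\mathbb T$. Here $\theta_n^p(z)=(\theta_n(z))^p$. *)

theory Defs
  imports "HOL-Complex_Analysis.Complex_Analysis"
begin

section \<open>Holomorphic functions of several variables and Shilov boundaries\<close>

text \<open>The derivative \<open>L\<close> is required to be complex linear; additivity and boundedness are
  already part of \<open>has_derivative\<close>.\<close>

definition holomorphic_several_on :: "(complex ^ 'n \<Rightarrow> complex) \<Rightarrow> (complex ^ 'n) set \<Rightarrow> bool"
  where "holomorphic_several_on f U \<longleftrightarrow>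
    (\<forall>x\<in>U. \<exists>L. (f has_derivative L) (at x) \<and> (\<forall>c v. L (c *s v) = c * L v))"

definition disc_algebra :: "(complex ^ 'n) set \<Rightarrow> (complex ^ 'n \<Rightarrow> complex) set"
  where "disc_algebra K = {f. continuous_on K f \<and> holomorphic_several_on f (interior K)}"

definition max_modulus_set :: "(complex ^ 'n) set \<Rightarrow> (complex ^ 'n) set \<Rightarrow> bool"
  where "max_modulus_set K C \<longleftrightarrow> closed C \<and> C \<subseteq> K \<and>
    (\<forall>f\<in>disc_algebra K. \<exists>x\<in>C. \<forall>y\<in>K. norm (f y) \<le> norm (f x))"

text \<open>The smallest set satisfying \<open>max_modulus_set K\<close>, written as the intersection of all such
  sets.\<close>

definition shilov_boundary :: "(complex ^ 'n) set \<Rightarrow> (complex ^ 'n) set"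
  where "shilov_boundary K = \<Inter> {C. max_modulus_set K C}"

section \<open>Inner functions\<close>

text \<open>Points of the unit circle are parametrised by their argument. The radial limit is required
  to exist almost everywhere; for bounded \<open>K\<close> this is automatic by Fatou's theorem.\<close>

definition inner_function :: "(complex ^ 'n) set \<Rightarrow> (complex \<Rightarrow> complex ^ 'n) \<Rightarrow> bool"
  where "inner_function K f \<longleftrightarrow>
    (\<forall>j. (\<lambda>z. f z $ j) holomorphic_on ball 0 1) \<and>
    f ` ball 0 1 \<subseteq> K \<and>
    (AE t in lebesgue_on {0..2 * pi}.
       \<exists>l\<in>shilov_boundary K. ((\<lambda>r. f (of_real r * cis t)) \<longlongrightarrow> l) (at_left 1))"

section \<open>The domains\<close>

definition elem_sym :: "nat \<Rightarrow> complex ^ 'n \<Rightarrow> complex"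
  where "elem_sym i z = (\<Sum>S | card S = i. \<Prod>j\<in>S. z $ j)"

text \<open>The index type \<open>'n\<close> has \<open>n\<close> elements; a bijection \<open>e\<close> from \<open>{1..n}\<close> onto it numbers the
  coordinates, so that the \<open>i\<close>-th coordinate of \<open>x\<close> is \<open>x $ e i\<close>.\<close>

definition theta :: "(nat \<Rightarrow> 'n) \<Rightarrow> nat \<Rightarrow> nat \<Rightarrow> complex ^ 'n \<Rightarrow> complex ^ 'n"
  where "theta e m p z = (\<chi> j.
    let i = inv_into {1..CARD('n)} e j
    in if i < CARD('n) then elem_sym i (\<chi> l. (z $ l) ^ m)
       else (\<Prod>l\<in>UNIV. z $ l) ^ (m div p))"

definition closed_Theta :: "(nat \<Rightarrow> 'n) \<Rightarrow> nat \<Rightarrow> nat \<Rightarrow> (complex ^ 'n) set"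
  where "closed_Theta e m p = theta e m p ` {z. \<forall>l. norm (z $ l) \<le> 1}"

definition tetrablock :: "(complex ^ 3) set"
  where "tetrablock = {x. \<forall>z w. norm z \<le> 1 \<and> norm w \<le> 1 \<longrightarrow>
    1 - z * x $ 1 - w * x $ 2 + z * w * x $ 3 \<noteq> 0}"

definition Theta_inner :: "(nat \<Rightarrow> 'n) \<Rightarrow> nat \<Rightarrow> nat \<Rightarrow> (complex \<Rightarrow> complex ^ 'n) \<Rightarrow> bool"
  where "Theta_inner e m p f \<longleftrightarrow> inner_function (closed_Theta e m p) f"

definition E_inner :: "(complex \<Rightarrow> complex ^ 3) \<Rightarrow> bool"
  where "E_inner f \<longleftrightarrow> inner_function (closure tetrablock) f"

end

theory Submission
  imports Defs
    "HOL-Computational_Algebra.Fundamental_Theorem_Algebra"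
    "HOL-Real_Asymp.Real_Asymp"
begin

no_notation fps_nth (infixl "$" 75)

text \<open>
  By Pascal's rule \<open>k i\<close> is the binomial coefficient \<open>n choose i\<close>. If \<open>\<Theta> z = theta e m p \<zeta>\<close> and
  \<open>w\<close> has the coordinates \<open>w\<^sub>j = \<zeta>\<^sub>j ^ m\<close>, the triple in question is
  \<open>x = (s\<^sub>i(w) / k i, s\<^sub>n\<^sub>-\<^sub>i(w) / k i, w\<^sub>1 \<dots> w\<^sub>n)\<close>, called \<open>sym_point i w\<close> below. Two things have to
  be shown: \<open>x\<close> lies in the closed tetrablock for \<open>w\<close> in the closed polydisc, and radial limits
  in the Shilov boundary of the source are sent into the Shilov boundary of the closed tetrablock.

  If all \<open>|w\<^sub>j| = 1\<close>, then \<open>s\<^sub>i(w)\<close> is the conjugate of \<open>s\<^sub>n\<^sub>-\<^sub>i(w)\<close> times the product of the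
  \<open>w\<^sub>j\<close>, hence \<open>x\<^sub>1 = cnj x\<^sub>2 x\<^sub>3\<close>, \<open>|x\<^sub>2| \<le> 1\<close> and \<open>|x\<^sub>3| = 1\<close>. At such points
  \<open>|x\<^sub>1 - t x\<^sub>3| \<le> |1 - t x\<^sub>2|\<close> for \<open>|t| < 1\<close>; by the maximum principle on the polydisc
  (\<open>polydisc_maximum_modulus\<close>) this inequality persists for all \<open>w\<close> in the closed polydisc, and it
  implies that \<open>x\<close> is in the closed tetrablock (\<open>sym_point_closed_polydisc\<close>).

  It remains to see that the Shilov boundary of the closed image of \<open>theta e m p\<close> lies in the image
  of the torus, and that all points with \<open>x\<^sub>1 = cnj x\<^sub>2 x\<^sub>3\<close>, \<open>|x\<^sub>2| \<le> 1\<close> and \<open>|x\<^sub>3| = 1\<close> lie in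
  the Shilov boundary of the closed tetrablock. Every function in the disc algebra of the closed
  image becomes, after composition with \<open>theta e m p\<close>, holomorphic on the polydisc, so it attains its maximum modulus on the image of the torus
  (\<open>shilov_boundary_closed_Theta\<close>). This uses that the image of the open polydisc is open, which
  holds because a point is in that image iff the polynomial with the corresponding coefficients has
  all its roots in the open disc. On the other side, every point of
  \<open>{x. x\<^sub>1 = cnj x\<^sub>2 x\<^sub>3, |x\<^sub>2| < 1, |x\<^sub>3| = 1}\<close> is a peak point of the disc algebra of the closed
  tetrablock, with an explicit rational peak function, and the points with \<open>|x\<^sub>2| = 1\<close> are limits
  of these (\<open>tetrablock_boundary_subset_shilov\<close>).
\<close>

section \<open>Maximum modulus on the polydisc\<close>

definition polydisc :: "(complex ^ 'n) set"
  where "polydisc = {z. \<forall>l. norm (z $ l) < 1}"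

definition closed_polydisc :: "(complex ^ 'n) set"
  where "closed_polydisc = {z. \<forall>l. norm (z $ l) \<le> 1}"

definition torus :: "(complex ^ 'n) set"
  where "torus = {z. \<forall>l. norm (z $ l) = 1}"

text \<open>The map \<open>t \<mapsto> upd z l t\<close> parametrises the coordinate line through \<open>z\<close> in direction
  \<open>l\<close>; separate holomorphy is holomorphy along all these lines.\<close>

definition upd :: "complex ^ 'n \<Rightarrow> 'n \<Rightarrow> complex \<Rightarrow> complex ^ 'n"
  where "upd z l t = (\<chi> j. if j = l then t else z $ j)"

lemma upd_nth [simp]: "upd z l t $ j = (if j = l then t else z $ j)"
  by (simp add: upd_def)

lemma compact_torus: "compact (torus :: (complex ^ 'n::finite) set)"
proof -
  have "closed (torus :: (complex ^ 'n) set)"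
    unfolding torus_def by (intro closed_Collect_all closed_Collect_eq continuous_intros)
  moreover have "norm z \<le> real CARD('n)" if "z \<in> torus" for z :: "complex ^ 'n"
    using L2_set_le_sum[of UNIV "\<lambda>i. norm (z $ i)"] that
    by (simp add: norm_vec_def torus_def)
  ultimately show ?thesis
    by (auto simp: compact_eq_bounded_closed bounded_iff)
qed

lemma torus_subset_closed_polydisc: "torus \<subseteq> closed_polydisc"
  by (auto simp: torus_def closed_polydisc_def)

lemma holomorphic_upd_nth: "(\<lambda>t. upd z l t $ j) holomorphic_on A"
  by (cases "j = l") auto

lemma increase_modulus_one_coordinate:
  fixes g :: "complex ^ 'n \<Rightarrow> complex"
  assumes hol: "\<And>z l. z \<in> polydisc \<Longrightarrow> (\<lambda>t. g (upd z l t)) holomorphic_on ball 0 1"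
    and r: "0 < r" "r < 1" and z: "\<And>j. norm (z $ j) \<le> r"
  obtains t where "norm t = r" "norm (g z) \<le> norm (g (upd z l t))"
proof -
  let ?h = "\<lambda>t. g (upd z l t)"
  have zD: "z \<in> polydisc"
    using z r by (auto simp: polydisc_def intro: le_less_trans)
  have holb: "?h holomorphic_on ball 0 1" by (rule hol[OF zD])
  have conth: "continuous_on (cball 0 r) ?h"
    by (rule holomorphic_on_imp_continuous_on, rule holomorphic_on_subset[OF holb]) (use r in auto)
  have "continuous_on (sphere 0 r) (\<lambda>t. norm (?h t))"
    by (intro continuous_on_norm continuous_on_subset[OF conth]) auto
  moreover have "sphere (0::complex) r \<noteq> {}" using r by auto
  ultimately obtain t where t: "t \<in> sphere 0 r" "\<And>s. s \<in> sphere 0 r \<Longrightarrow> norm (?h s) \<le> norm (?h t)"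
    using continuous_attains_sup[OF compact_sphere] by blast
  have "norm (?h (z $ l)) \<le> norm (?h t)"
  proof (rule maximum_modulus_frontier[where S = "cball 0 r" and f = ?h and \<xi> = "z $ l"])
    show "?h holomorphic_on interior (cball 0 r)"
      by (rule holomorphic_on_subset[OF holb]) (use r in auto)
  qed (use conth r z t in auto)
  moreover have "upd z l (z $ l) = z" by (simp add: vec_eq_iff)
  ultimately show ?thesis using t that by auto
qed

text \<open>Replacing the coordinates one after the other never leaves the open polydisc, because all
  coordinates are moved to the radius \<open>r < 1\<close> only. This is why the boundary is reached in a
  separate limit \<open>r \<rightarrow> 1\<close>: slices through boundary points of the polydisc need not be
  holomorphic a priori.\<close>

lemma modulus_le_on_smaller_torus:
  fixes g :: "complex ^ 'n::finite \<Rightarrow> complex"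
  assumes hol: "\<And>z l. z \<in> polydisc \<Longrightarrow> (\<lambda>t. g (upd z l t)) holomorphic_on ball 0 1"
    and r: "0 < r" "r < 1" and z: "\<And>j. norm (z $ j) \<le> r"
  obtains u where "u \<in> torus" "norm (g z) \<le> norm (g (of_real r *s u))"
proof -
  have "\<exists>z'. (\<forall>j\<in>A. norm (z' $ j) = r) \<and> (\<forall>j. norm (z' $ j) \<le> r) \<and> norm (g z) \<le> norm (g z')"
    if "finite A" for A :: "'n set"
    using that
  proof (induction A)
    case empty
    then show ?case using z by auto
  next
    case (insert l A)
    then obtain z' where z': "\<And>j. j \<in> A \<Longrightarrow> norm (z' $ j) = r" "\<And>j. norm (z' $ j) \<le> r"
        "norm (g z) \<le> norm (g z')"
      by blast
    obtain t where t: "norm t = r" "norm (g z') \<le> norm (g (upd z' l t))"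
      by (rule increase_modulus_one_coordinate[OF hol r z'(2)])
    show ?case
      by (rule exI[of _ "upd z' l t"]) (use z' t insert in auto)
  qed
  from this[of UNIV] obtain z' where z': "\<And>j. norm (z' $ j) = r" "norm (g z) \<le> norm (g z')"
    by auto
  define u where "u = (1 / of_real r) *s z'"
  have "u \<in> torus" using z' r by (simp add: u_def torus_def norm_mult norm_divide)
  moreover have "of_real r *s u = z'" using r by (simp add: u_def vec_eq_iff)
  ultimately show ?thesis using that z' by metis
qed

text \<open>For a point \<open>z\<close>, the previous lemma gives \<open>u r\<close> on the torus with
  \<open>|g (r z)| \<le> |g (r u r)|\<close> for every \<open>r < 1\<close>; a subsequence of the \<open>u r\<close> converges as
  \<open>r \<rightarrow> 1\<close> by compactness of the torus.\<close>

theorem polydisc_maximum_modulus: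
  fixes g :: "complex ^ 'n::finite \<Rightarrow> complex"
  assumes cont: "continuous_on closed_polydisc g"
    and hol: "\<And>z l. z \<in> polydisc \<Longrightarrow> (\<lambda>t. g (upd z l t)) holomorphic_on ball 0 1"
  obtains u where "u \<in> torus" "\<And>z. z \<in> closed_polydisc \<Longrightarrow> norm (g z) \<le> norm (g u)"
proof -
  have "\<exists>u\<in>torus. norm (g z) \<le> norm (g u)" if z: "z \<in> closed_polydisc" for z
  proof -
    define r where "r = (\<lambda>k::nat. 1 - 1 / (real k + 2))"
    have r: "0 < r k" "r k < 1" for k by (auto simp: r_def field_simps)
    have r_lim: "r \<longlonglongrightarrow> 1" unfolding r_def by real_asymp
    have "\<exists>u. u \<in> torus \<and> norm (g (of_real (r k) *s z)) \<le> norm (g (of_real (r k) *s u))" for k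
    proof -
      have "norm ((of_real (r k) *s z) $ j) \<le> r k" for j
        using z r[of k] by (auto simp: closed_polydisc_def norm_mult intro!: mult_left_le)
      then show ?thesis
        using modulus_le_on_smaller_torus[OF hol r(1)[of k] r(2)[of k]] by metis
    qed
    then obtain u where u: "\<And>k. u k \<in> torus"
        "\<And>k. norm (g (of_real (r k) *s z)) \<le> norm (g (of_real (r k) *s u k))"
      by metis
    obtain v \<sigma> where v: "v \<in> torus" "strict_mono (\<sigma> :: nat \<Rightarrow> nat)" "(u \<circ> \<sigma>) \<longlonglongrightarrow> v"
      using seq_compactE[OF compact_imp_seq_compact[OF compact_torus], of u] u(1) by blast
    have r\<sigma>: "(\<lambda>k. complex_of_real (r (\<sigma> k))) \<longlonglongrightarrow> 1"
      using tendsto_of_real[OF LIMSEQ_subseq_LIMSEQ[OF r_lim v(2)]] by (simp add: o_def)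
    have lim: "(\<lambda>k. g (of_real (r (\<sigma> k)) *s w k)) \<longlonglongrightarrow> g w'"
      if w: "w \<longlonglongrightarrow> w'" "\<And>k. w k \<in> closed_polydisc" "w' \<in> closed_polydisc" for w w'
    proof (rule continuous_on_tendsto_compose[OF cont])
      have "(\<lambda>k. of_real (r (\<sigma> k)) *s w k) \<longlonglongrightarrow> 1 *s w'"
        unfolding vector_scalar_mult_def
        by (intro tendsto_vec_lambda tendsto_mult r\<sigma> tendsto_vec_nth w)
      then show "(\<lambda>k. of_real (r (\<sigma> k)) *s w k) \<longlonglongrightarrow> w'" by simp
      show "\<forall>\<^sub>F k in sequentially. of_real (r (\<sigma> k)) *s w k \<in> closed_polydisc"
        using w(2) r by (auto simp: closed_polydisc_def norm_mult less_imp_le intro!: mult_le_one always_eventually)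
    qed (use w in auto)
    have "norm (g z) \<le> norm (g v)"
    proof (rule LIMSEQ_le)
      show "(\<lambda>k. norm (g (of_real (r (\<sigma> k)) *s z))) \<longlonglongrightarrow> norm (g z)"
        by (intro tendsto_norm lim) (use z in auto)
      show "(\<lambda>k. norm (g (of_real (r (\<sigma> k)) *s u (\<sigma> k)))) \<longlonglongrightarrow> norm (g v)"
        by (intro tendsto_norm lim) (use v u torus_subset_closed_polydisc in \<open>auto simp: o_def\<close>)
      show "\<exists>N. \<forall>k\<ge>N. norm (g (of_real (r (\<sigma> k)) *s z)) \<le> norm (g (of_real (r (\<sigma> k)) *s u (\<sigma> k)))"
        using u by auto
    qed
    then show ?thesis using v by auto
  qed
  moreover have "\<exists>u\<in>torus. \<forall>v\<in>torus. norm (g v) \<le> norm (g u)"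
  proof (rule continuous_attains_sup[OF compact_torus])
    have "(1 :: complex ^ 'n) \<in> torus" by (simp add: torus_def)
    then show "torus \<noteq> ({} :: (complex ^ 'n) set)" by blast
    show "continuous_on torus (\<lambda>v. norm (g v))"
      by (intro continuous_on_norm continuous_on_subset[OF cont] torus_subset_closed_polydisc)
  qed
  ultimately show ?thesis using that by (meson order_trans)
qed

section \<open>Elementary symmetric polynomials\<close>

lemma elem_sym_0 [simp]: "elem_sym 0 w = 1"
  by (simp add: elem_sym_def)

lemma elem_sym_card: "elem_sym CARD('n) (w :: complex ^ 'n::finite) = (\<Prod>j\<in>UNIV. w $ j)"
proof -
  have "{S :: 'n set. card S = CARD('n)} = {UNIV}"
    using card_subset_eq[of "UNIV :: 'n set"] by auto
  then show ?thesis by (simp add: elem_sym_def)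
qed

lemma norm_elem_sym_le:
  assumes "\<And>j. norm (w $ j) \<le> 1"
  shows "norm (elem_sym i (w :: complex ^ 'n::finite)) \<le> real (CARD('n) choose i)"
proof -
  have "norm (elem_sym i w) \<le> (\<Sum>S | card (S :: 'n set) = i. 1)"
    unfolding elem_sym_def
    by (rule sum_norm_le) (auto simp: assms prod_norm[symmetric] intro!: prod_le_1)
  also have "\<dots> = real (card {S :: 'n set. S \<subseteq> UNIV \<and> card S = i})" by simp
  also have "card {S :: 'n set. S \<subseteq> UNIV \<and> card S = i} = CARD('n) choose i"
    by (rule n_subsets) simp
  finally show ?thesis .
qed

text \<open>On the torus \<open>1 / w $ j\<close> is the conjugate of \<open>w $ j\<close>, so the product over a set is the
  product of all coordinates times the conjugate of the product over the complement.\<close>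

lemma elem_sym_reflect_torus:
  fixes w :: "complex ^ 'n::finite"
  assumes w: "\<And>j. norm (w $ j) = 1" and i: "i \<le> CARD('n)"
  shows "elem_sym i w = cnj (elem_sym (CARD('n) - i) w) * (\<Prod>j\<in>UNIV. w $ j)"
proof -
  have 1: "(\<Prod>j\<in>S. w $ j) = cnj (\<Prod>j\<in>-S. w $ j) * (\<Prod>j\<in>UNIV. w $ j)" for S
  proof -
    have "(\<Prod>j\<in>UNIV. w $ j) = (\<Prod>j\<in>S. w $ j) * (\<Prod>j\<in>-S. w $ j)"
      using prod.union_disjoint[of S "-S" "\<lambda>j. w $ j"] by (simp add: Compl_partition)
    moreover have "(\<Prod>j\<in>-S. w $ j) * cnj (\<Prod>j\<in>-S. w $ j) = 1"
      by (subst complex_norm_square[symmetric]) (simp add: prod_norm[symmetric] w)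
    ultimately show ?thesis by (simp add: algebra_simps)
  qed
  have "elem_sym i w = (\<Sum>S | card S = CARD('n) - i. \<Prod>j\<in>-S. w $ j)"
    unfolding elem_sym_def
    by (rule sum.reindex_bij_witness[of _ uminus uminus]) (use i in \<open>auto simp: Compl_eq_Diff_UNIV card_Diff_subset double_diff\<close>)
  also have "\<dots> = (\<Sum>S | card S = CARD('n) - i. cnj (\<Prod>j\<in>S. w $ j) * (\<Prod>j\<in>UNIV. w $ j))"
    by (subst 1) simp
  also have "\<dots> = cnj (elem_sym (CARD('n) - i) w) * (\<Prod>j\<in>UNIV. w $ j)"
    by (simp add: elem_sym_def sum_distrib_right)
  finally show ?thesis .
qed

lemma continuous_on_elem_sym [continuous_intros]:
  "continuous_on A f \<Longrightarrow> continuous_on A (\<lambda>x. elem_sym i (f x))"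
  unfolding elem_sym_def by (intro continuous_intros)

lemma holomorphic_elem_sym:
  assumes "\<And>j. (\<lambda>t. f t $ j) holomorphic_on A"
  shows "(\<lambda>t. elem_sym i (f t)) holomorphic_on A"
  unfolding elem_sym_def by (intro holomorphic_on_sum holomorphic_on_prod assms)

text \<open>Vieta's formula, obtained by expanding the product over subsets and grouping the subsets
  by cardinality.\<close>

lemma prod_linear_eq_elem_sym:
  fixes w :: "complex ^ 'n::finite"
  shows "(\<Prod>j\<in>UNIV. [:- w $ j, 1:]) =
    (\<Sum>i\<le>CARD('n). monom ((-1) ^ i * elem_sym i w) (CARD('n) - i))"
proof -
  have mon: "(\<Prod>j\<in>S. [:- w $ j:]) = [:(-1) ^ card S * (\<Prod>j\<in>S. w $ j):]" for S
    using finite[of S] by (induction S rule: finite_induct) (auto simp: algebra_simps)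
  have "(\<Prod>j\<in>UNIV. [:- w $ j, 1:]) = (\<Prod>j\<in>UNIV. [:- w $ j:] + monom 1 1)"
    by (simp add: monom_altdef)
  also have "\<dots> = (\<Sum>S\<in>UNIV. (\<Prod>j\<in>S. [:- w $ j:]) * (\<Prod>j\<in>UNIV - S. monom 1 1))"
    by (subst prod_add) auto
  also have "\<dots> = (\<Sum>S\<in>UNIV. monom ((-1) ^ card S * (\<Prod>j\<in>S. w $ j)) (CARD('n) - card S))"
    by (intro sum.cong refl) (simp add: mon monom_power card_Diff_subset smult_monom)
  also have "\<dots> = (\<Sum>i\<le>CARD('n). \<Sum>S | card S = i.
      monom ((-1) ^ card S * (\<Prod>j\<in>S. w $ j)) (CARD('n) - card S))"
    by (subst sum.group[symmetric, where g = card and T = "{..CARD('n)}"])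
       (auto intro!: card_mono)
  also have "\<dots> = (\<Sum>i\<le>CARD('n). monom ((-1) ^ i * elem_sym i w) (CARD('n) - i))"
    by (intro sum.cong refl) (simp add: elem_sym_def sum_distrib_left monom_sum)
  finally show ?thesis .
qed

lemma coeff_sum_monom_reversed:
  fixes c :: "nat \<Rightarrow> 'a::comm_monoid_add"
  assumes "i \<le> N"
  shows "coeff (\<Sum>k\<le>N. monom (c k) (N - k)) (N - i) = c i"
proof -
  have "N - k = N - i \<longleftrightarrow> k = i" if "k \<le> N" for k
    using that assms by linarith
  then have "(\<Sum>k\<le>N. if N - k = N - i then c k else 0) = (\<Sum>k\<le>N. if k = i then c k else 0)"
    by (intro sum.cong) auto
  then show ?thesis using assms by (simp add: coeff_sum)
qed

section \<open>The image of the open polydisc is open\<close>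

definition coord_power :: "nat \<Rightarrow> complex ^ 'n \<Rightarrow> complex ^ 'n"
  where "coord_power m z = (\<chi> l. (z $ l) ^ m)"

lemma coord_power_nth [simp]: "coord_power m z $ l = (z $ l) ^ m"
  by (simp add: coord_power_def)

text \<open>A point \<open>y\<close> of the target space encodes the monic polynomial with these coefficients (up to
  sign); if \<open>y = theta e m p z\<close> then its roots are the numbers \<open>(z $ j) ^ m\<close>. The last coordinate
  enters through its \<open>p\<close>-th power, since it is itself only a \<open>p\<close>-th root of the product of these
  roots.\<close>

definition char_coeff :: "(nat \<Rightarrow> 'n::finite) \<Rightarrow> nat \<Rightarrow> complex ^ 'n \<Rightarrow> nat \<Rightarrow> complex"
  where "char_coeff e p y i =
    (if i = 0 then 1 else if i < CARD('n) then y $ e i else (y $ e CARD('n)) ^ p)"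

definition char_poly :: "(nat \<Rightarrow> 'n::finite) \<Rightarrow> nat \<Rightarrow> complex ^ 'n \<Rightarrow> complex poly"
  where "char_poly e p y =
    (\<Sum>i\<le>CARD('n). monom ((-1) ^ i * char_coeff e p y i) (CARD('n) - i))"

locale theta_map =
  fixes e :: "nat \<Rightarrow> 'n::finite" and m p :: nat
  assumes m: "m > 0" and p: "p > 0" and dvd: "p dvd m"
    and e: "bij_betw e {1..CARD('n)} UNIV"
begin

lemma inv_e: "i \<in> {1..CARD('n)} \<Longrightarrow> inv_into {1..CARD('n)} e (e i) = i"
  using e by (intro inv_into_f_f) (auto simp: bij_betw_def)

lemma e_cases: obtains i where "1 \<le> i" "i \<le> CARD('n)" "j = e i"
proof -
  have "j \<in> e ` {1..CARD('n)}" using e by (simp add: bij_betw_def)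
  then show ?thesis using that by auto
qed

lemma theta_nth:
  "1 \<le> i \<Longrightarrow> i < CARD('n) \<Longrightarrow> theta e m p z $ e i = elem_sym i (coord_power m z)"
  using inv_e[of i] by (simp add: theta_def Let_def coord_power_def)

lemma theta_last: "theta e m p z $ e CARD('n) = (\<Prod>l\<in>UNIV. z $ l) ^ (m div p)"
  using inv_e[of "CARD('n)"] by (simp add: theta_def Let_def Suc_le_eq)

lemma theta_last_power: "(theta e m p z $ e CARD('n)) ^ p = (\<Prod>l\<in>UNIV. coord_power m z $ l)"
  using dvd by (simp add: theta_last power_mult[symmetric] prod_power_distrib)

lemma char_coeff_theta:
  "i \<le> CARD('n) \<Longrightarrow> char_coeff e p (theta e m p z) i = elem_sym i (coord_power m z)"
  using theta_nth[of i z] theta_last_power[of z]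
  by (auto simp: char_coeff_def elem_sym_card)

lemma char_poly_theta: "char_poly e p (theta e m p z) = (\<Prod>j\<in>UNIV. [:- ((z $ j) ^ m), 1:])"
  using prod_linear_eq_elem_sym[of "coord_power m z"]
  by (simp add: char_poly_def char_coeff_theta)

lemma char_poly_factorization:
  obtains w :: "complex ^ 'n" where "char_poly e p y = (\<Prod>j\<in>UNIV. [:- w $ j, 1:])"
    "\<forall>i\<le>CARD('n). elem_sym i w = char_coeff e p y i"
proof -
  have coeff: "coeff (char_poly e p y) (CARD('n) - i) = (-1) ^ i * char_coeff e p y i"
    if "i \<le> CARD('n)" for i
    unfolding char_poly_def by (rule coeff_sum_monom_reversed[OF that])
  have lead: "coeff (char_poly e p y) CARD('n) = 1"
    using coeff[of 0] by (simp add: char_coeff_def)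
  have "degree (char_poly e p y) \<le> CARD('n)"
    unfolding char_poly_def
    by (intro degree_sum_le) (auto intro: order_trans[OF degree_monom_le])
  then have deg: "degree (char_poly e p y) = CARD('n)"
    using lead le_degree[of "char_poly e p y" "CARD('n)"] by simp
  obtain root where
    "smult (lead_coeff (char_poly e p y)) (\<Prod>i<degree (char_poly e p y). [:- root i, 1:]) = char_poly e p y"
    by (rule complex_poly_decompose')
  then have root: "char_poly e p y = (\<Prod>i<CARD('n). [:- root i, 1:])"
    by (simp add: deg lead)
  define w :: "complex ^ 'n" where "w = (\<chi> j. root (inv_into {1..CARD('n)} e j - 1))"
  have "(\<Prod>i<CARD('n). [:- root i, 1:]) = (\<Prod>i\<in>{1..CARD('n)}. [:- root (i - 1), 1:])"
    by (rule prod.reindex_bij_witness[of _ "\<lambda>i. i - 1" Suc]) auto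
  also have "\<dots> = (\<Prod>i\<in>{1..CARD('n)}. [:- w $ e i, 1:])"
    by (intro prod.cong refl) (simp add: w_def inv_e del: One_nat_def)
  also have "\<dots> = (\<Prod>j\<in>UNIV. [:- w $ j, 1:])"
    by (rule prod.reindex_bij_betw[OF e])
  finally have w: "char_poly e p y = (\<Prod>j\<in>UNIV. [:- w $ j, 1:])"
    using root by simp
  moreover have "elem_sym i w = char_coeff e p y i" if "i \<le> CARD('n)" for i
    using coeff[OF that] coeff_sum_monom_reversed[OF that, of "\<lambda>i. (-1) ^ i * elem_sym i w"] w
    by (simp add: prod_linear_eq_elem_sym)
  ultimately show ?thesis using that by blast
qed

text \<open>Choosing \<open>m\<close>-th roots of the coordinates of \<open>w\<close> arbitrarily gives all coordinates of \<open>y\<close>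
  except the last one, which may be off by a \<open>p\<close>-th root of unity. Multiplying one chosen root by
  a suitable \<open>m\<close>-th root of unity \<open>c\<close> corrects this and changes nothing else.\<close>

lemma theta_surj:
  fixes w y :: "complex ^ 'n"
  assumes w: "\<And>i. i \<le> CARD('n) \<Longrightarrow> elem_sym i w = char_coeff e p y i"
  obtains z where "coord_power m z = w" "theta e m p z = y"
proof -
  define q where "q = m div p"
  have q: "q > 0" "q * p = m" using m p dvd by (auto simp: q_def div_greater_zero_iff dvd_imp_le)
  have root: "\<exists>b. b ^ k = a" if "k > 0" for a :: complex and k
    using nth_root_exists[of k a] that by blast
  have "\<forall>l. \<exists>b. b ^ m = w $ l" using root[OF m] by blast
  then obtain b where b: "\<And>l. b l ^ m = w $ l" using choice by meson
  define P where "P = (\<Prod>l\<in>UNIV. b l)"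
  have "elem_sym CARD('n) w = (y $ e CARD('n)) ^ p" 
    using w[of "CARD('n)"] by (simp add: char_coeff_def)
  then have Pw: "(P ^ q) ^ p = (y $ e CARD('n)) ^ p"
    by (simp add: P_def elem_sym_card power_mult[symmetric] q prod_power_distrib b)
  obtain c where c: "c ^ m = 1" "(c * P) ^ q = y $ e CARD('n)"
  proof (cases "P = 0")
    case True
    then have "y $ e CARD('n) = 0" using Pw p q by (simp add: power_0_left)
    then show ?thesis using True that[of 1] q by simp
  next
    case False
    obtain c where c: "c ^ q = y $ e CARD('n) / P ^ q" using root[OF q(1)] by blast
    have "c ^ m = (c ^ q) ^ p" using q by (simp flip: power_mult)
    also have "\<dots> = 1" using False by (simp add: c power_divide Pw[symmetric])
    finally have "c ^ m = 1" .
    moreover have "(c * P) ^ q = y $ e CARD('n)" using False by (simp add: power_mult_distrib c)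
    ultimately show ?thesis using that by blast
  qed
  \<comment> \<open>\<open>undefined\<close> serves as an arbitrary index at which to place the factor \<open>c\<close>.\<close>
  define z :: "complex ^ 'n" where "z = (\<chi> l. if l = undefined then c * b l else b l)"
  have zw: "coord_power m z = w" by (simp add: vec_eq_iff z_def power_mult_distrib c b)
  have "(\<Prod>l\<in>UNIV. z $ l) = c * P"
    using prod.remove[of UNIV undefined "\<lambda>l. z $ l"] prod.remove[of UNIV undefined b]
    by (simp add: P_def z_def)
  then have last: "theta e m p z $ e CARD('n) = y $ e CARD('n)"
    using c by (simp add: theta_last q_def)
  have "theta e m p z $ j = y $ j" for j
  proof -
    obtain i where i: "1 \<le> i" "i \<le> CARD('n)" "j = e i" by (rule e_cases)
    then show ?thesis using last theta_nth[of i z] w[of i]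
      by (cases "i = CARD('n)") (auto simp: zw char_coeff_def)
  qed
  then show ?thesis using that zw by (simp add: vec_eq_iff)
qed

text \<open>The moduli of the roots are the \<open>m\<close>-th powers of the moduli of the coordinates of any
  preimage, so the polynomial decides whether there is a preimage in the polydisc.\<close>

lemma theta_polydisc:
  "theta e m p ` polydisc = {y. \<forall>t. 1 \<le> norm t \<longrightarrow> poly (char_poly e p y) t \<noteq> 0}"
proof (intro equalityI subsetI CollectI allI impI)
  fix y t assume "y \<in> theta e m p ` polydisc" and t: "1 \<le> norm (t :: complex)"
  then obtain z where z: "\<And>l. norm (z $ l) < 1" "y = theta e m p z" by (auto simp: polydisc_def)
  have "norm (z $ j ^ m) < 1" for j
    using z m by (simp add: norm_power power_less_one_iff)
  then have "t \<noteq> z $ j ^ m" for j using t by (metis not_le)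
  then show "poly (char_poly e p y) t \<noteq> 0"
    by (simp add: z(2) char_poly_theta poly_prod)
next
  fix y assume "y \<in> {y. \<forall>t. 1 \<le> norm t \<longrightarrow> poly (char_poly e p y) t \<noteq> 0}"
  then have y: "norm t < 1" if "poly (char_poly e p y) t = 0" for t
    using that by (auto simp: not_le[symmetric])
  obtain w :: "complex ^ 'n" where w: "char_poly e p y = (\<Prod>j\<in>UNIV. [:- w $ j, 1:])"
    "\<forall>i\<le>CARD('n). elem_sym i w = char_coeff e p y i"
    by (rule char_poly_factorization[of y])
  obtain z where z: "coord_power m z = w" "theta e m p z = y"
    by (rule theta_surj[OF w(2)[rule_format]])
  have "norm (z $ j) < 1" for j
  proof -
    have "norm (w $ j) < 1" by (intro y) (auto simp: w(1) poly_prod)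
    then have "norm (z $ j) ^ m < 1" by (simp add: z(1)[symmetric] norm_power)
    then show ?thesis using m by (simp add: power_less_one_iff)
  qed
  then show "y \<in> theta e m p ` polydisc" using z(2) by (auto simp: polydisc_def)
qed

text \<open>Passing to the reversed polynomial moves the roots outside the disc into the compact closed
  disc, so that the set of \<open>y\<close> having such a root is a projection along a compact factor.\<close>

lemma poly_char_poly_reversed:
  assumes "s \<noteq> 0"
  shows "poly (char_poly e p y) (inverse s) = 0 \<longleftrightarrow>
    (\<Sum>i\<le>CARD('n). (-1) ^ i * char_coeff e p y i * s ^ i) = 0"
proof -
  have "s ^ CARD('n) * poly (char_poly e p y) (inverse s) =
      (\<Sum>i\<le>CARD('n). (-1) ^ i * char_coeff e p y i * s ^ i)"
    unfolding char_poly_def poly_sum sum_distrib_left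
  proof (intro sum.cong refl)
    fix i assume "i \<in> {..CARD('n)}"
    then have "s ^ CARD('n) = s ^ i * s ^ (CARD('n) - i)" by (simp flip: power_add)
    then show "s ^ CARD('n) * poly (monom ((-1) ^ i * char_coeff e p y i) (CARD('n) - i)) (inverse s)
        = (-1) ^ i * char_coeff e p y i * s ^ i"
      using assms by (simp add: poly_monom power_inverse field_simps)
  qed
  then show ?thesis using assms by (metis mult_eq_0_iff power_eq_0_iff)
qed

lemma open_theta_polydisc: "open (theta e m p ` polydisc)"
proof -
  let ?Q = "\<lambda>s y. \<Sum>i\<le>CARD('n). (-1) ^ i * char_coeff e p y i * s ^ i"
  let ?Z = "{x :: complex \<times> (complex ^ 'n). ?Q (fst x) (snd x) = 0}"
  have "continuous_on UNIV (\<lambda>x. char_coeff e p (snd x) i)" for i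
    by (cases "i = 0"; cases "i < CARD('n)")
       (auto simp: char_coeff_def intro!: continuous_intros)
  then have "closed ?Z" by (intro closed_Collect_eq continuous_intros)
  then have "closed {y. \<exists>s. s \<in> cball 0 1 \<and> (s, y) \<in> ?Z}"
    by (intro closed_compact_projection compact_cball)
  moreover have "{y. \<exists>s. s \<in> cball 0 1 \<and> (s, y) \<in> ?Z} = - theta e m p ` polydisc"
  proof -
    have "(\<exists>s\<in>cball 0 1. ?Q s y = 0) \<longleftrightarrow> (\<exists>t. 1 \<le> norm t \<and> poly (char_poly e p y) t = 0)" for y
    proof
      assume "\<exists>s\<in>cball 0 1. ?Q s y = 0"
      then obtain s where s: "s \<in> cball 0 1" "?Q s y = 0" by blast
      have "?Q 0 y = (\<Sum>i\<le>CARD('n). if i = 0 then 1 else 0)"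
        by (intro sum.cong) (auto simp: char_coeff_def)
      then have "?Q 0 y = 1" by simp
      then have "s \<noteq> 0" using s(2) by auto
      then show "\<exists>t. 1 \<le> norm t \<and> poly (char_poly e p y) t = 0"
        using s poly_char_poly_reversed[of s y]
        by (intro exI[of _ "inverse s"]) (simp add: norm_inverse one_le_inverse)
    next
      assume "\<exists>t. 1 \<le> norm t \<and> poly (char_poly e p y) t = 0"
      then obtain t where t: "1 \<le> norm t" "poly (char_poly e p y) t = 0" by blast
      then have "inverse t \<noteq> 0" by auto
      then show "\<exists>s\<in>cball 0 1. ?Q s y = 0"
        using t poly_char_poly_reversed[of "inverse t" y]
        by (intro bexI[of _ "inverse t"]) (simp_all add: norm_inverse inverse_le_1_iff)
    qed
    then show ?thesis unfolding theta_polydisc by (auto simp only: set_eq_iff mem_Collect_eq Compl_iff fst_conv snd_conv Bex_def)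
  qed
  ultimately show ?thesis by (simp add: closed_open)
qed

end

section \<open>The Shilov boundary of the closed image lies in the image of the torus\<close>

lemma has_derivative_vec_lambda:
  fixes f :: "'a::real_normed_vector \<Rightarrow> complex ^ 'n::finite"
  assumes "\<And>j. ((\<lambda>x. f x $ j) has_derivative (\<lambda>h. f' h $ j)) (at x)"
  shows "(f has_derivative f') (at x)"
  unfolding has_derivative_componentwise_within[of f f' x UNIV, simplified]
proof
  fix b :: "complex ^ 'n" assume "b \<in> Basis"
  then obtain j c where b: "b = axis j c" by (auto simp: Basis_vec_def)
  show "((\<lambda>x. f x \<bullet> b) has_derivative (\<lambda>h. f' h \<bullet> b)) (at x)"
    unfolding b inner_axis by (intro has_derivative_inner_left assms)
qed

lemma holomorphic_several_on_compose:
  fixes F :: "complex \<Rightarrow> complex ^ 'n::finite"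
  assumes f: "holomorphic_several_on f U"
    and F: "\<And>j. (\<lambda>t. F t $ j) holomorphic_on A" and A: "open A" and FU: "F ` A \<subseteq> U"
  shows "(\<lambda>t. f (F t)) holomorphic_on A"
proof (rule holomorphic_onI)
  fix t assume t: "t \<in> A"
  define v where "v = (\<chi> j. deriv (\<lambda>t. F t $ j) t)"
  obtain L where L: "(f has_derivative L) (at (F t))" "\<And>c v. L (c *s v) = c * L v"
    using f FU t unfolding holomorphic_several_on_def by blast
  have "(F has_derivative (\<lambda>h. h *s v)) (at t)"
  proof (rule has_derivative_vec_lambda)
    fix j
    have "((\<lambda>t. F t $ j) has_field_derivative v $ j) (at t)"
      using holomorphic_derivI[OF F A t] by (simp add: v_def)
    then show "((\<lambda>t. F t $ j) has_derivative (\<lambda>h. (h *s v) $ j)) (at t)"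
      by (simp add: has_field_derivative_def mult.commute[of _ "v $ j"])
  qed
  then have "((\<lambda>t. f (F t)) has_derivative (\<lambda>h. L (h *s v))) (at t)"
    using L(1) by (rule has_derivative_compose)
  then have "((\<lambda>t. f (F t)) has_field_derivative L v) (at t)"
    by (simp add: has_field_derivative_def L(2) mult.commute[of _ "L v"])
  then show "(\<lambda>t. f (F t)) field_differentiable at t within A"
    using field_differentiable_def field_differentiable_at_within by blast
qed

context theta_map
begin

lemma theta_nth_cases:
  "theta e m p z $ j = (if inv_into {1..CARD('n)} e j < CARD('n)
     then elem_sym (inv_into {1..CARD('n)} e j) (coord_power m z)
     else (\<Prod>l\<in>UNIV. z $ l) ^ (m div p))"
  by (simp add: theta_def Let_def coord_power_def)

lemma continuous_on_theta: "continuous_on A (theta e m p)"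
proof -
  have "continuous_on A (\<lambda>z. theta e m p z $ j)" for j
    unfolding theta_nth_cases coord_power_def
    by (cases "inv_into {1..CARD('n)} e j < CARD('n)") (simp_all only: if_True if_False, (intro continuous_intros)+)
  then have "continuous_on A (\<lambda>z. \<chi> j. theta e m p z $ j)"
    by (intro continuous_on_vec_lambda)
  then show ?thesis by simp
qed

lemma holomorphic_theta_upd: "(\<lambda>t. theta e m p (upd z l t) $ j) holomorphic_on A"
proof -
  have "(\<lambda>t. elem_sym i (coord_power m (upd z l t))) holomorphic_on A" for i
    by (rule holomorphic_elem_sym) (simp only: coord_power_nth, intro holomorphic_intros holomorphic_upd_nth)
  moreover have "(\<lambda>t. (\<Prod>k\<in>UNIV. upd z l t $ k) ^ (m div p)) holomorphic_on A"
    by (intro holomorphic_intros holomorphic_upd_nth)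
  ultimately show ?thesis unfolding theta_nth_cases by (cases "inv_into {1..CARD('n)} e j < CARD('n)") simp_all
qed

text \<open>If \<open>f\<close> is in the disc algebra of the image, then the composition of \<open>f\<close> with \<open>theta e m p\<close>
  is holomorphic on the open polydisc, as the latter is mapped into the interior. The maximum
  principle on the polydisc therefore makes the image of the torus a maximum modulus set.\<close>

theorem shilov_boundary_closed_Theta:
  "shilov_boundary (closed_Theta e m p) \<subseteq> theta e m p ` torus"
proof -
  let ?K = "closed_Theta e m p"
  have K: "?K = theta e m p ` closed_polydisc"
    by (simp add: closed_Theta_def closed_polydisc_def)
  have "polydisc \<subseteq> (closed_polydisc :: (complex ^ 'n) set)"
    by (auto simp: polydisc_def closed_polydisc_def less_imp_le)
  then have int: "theta e m p ` polydisc \<subseteq> interior ?K"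
    unfolding K by (intro interior_maximal open_theta_polydisc image_mono)
  have "\<exists>x\<in>theta e m p ` torus. \<forall>y\<in>?K. norm (f y) \<le> norm (f x)"
    if f: "f \<in> disc_algebra ?K" for f
  proof -
    let ?g = "\<lambda>z. f (theta e m p z)"
    have "continuous_on closed_polydisc ?g"
    proof (rule continuous_on_compose2[OF _ continuous_on_theta])
      show "continuous_on ?K f" using f by (simp add: disc_algebra_def)
      show "theta e m p ` closed_polydisc \<subseteq> ?K" using K by simp
    qed
    moreover have "(\<lambda>t. ?g (upd z l t)) holomorphic_on ball 0 1" if "z \<in> polydisc" for z l
    proof (rule holomorphic_several_on_compose[OF _ holomorphic_theta_upd])
      show "holomorphic_several_on f (interior ?K)" using f by (simp add: disc_algebra_def)
      have "upd z l t \<in> polydisc" if "t \<in> ball 0 1" for t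
        using that \<open>z \<in> polydisc\<close> by (auto simp: polydisc_def)
      then show "(\<lambda>t. theta e m p (upd z l t)) ` ball 0 1 \<subseteq> interior ?K"
        using int by blast
    qed simp
    ultimately obtain u where "u \<in> torus" "\<And>z. z \<in> closed_polydisc \<Longrightarrow> norm (?g z) \<le> norm (?g u)"
      using polydisc_maximum_modulus[of ?g] by blast
    then show ?thesis by (auto simp: K)
  qed
  moreover have "closed (theta e m p ` torus)"
    by (intro compact_imp_closed compact_continuous_image compact_torus continuous_on_theta)
  moreover have "theta e m p ` torus \<subseteq> ?K"
    using torus_subset_closed_polydisc K by blast
  ultimately have "max_modulus_set ?K (theta e m p ` torus)"
    by (simp add: max_modulus_set_def)
  then show ?thesis by (auto simp: shilov_boundary_def)
qed

end

section \<open>Estimates on the closed tetrablock\<close>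

lemma norm_mult_less_1:
  fixes a b :: complex
  assumes "norm a < 1" "norm b \<le> 1"
  shows "norm (a * b) < 1"
proof -
  have "norm a * norm b \<le> norm a * 1" using assms(2) by (intro mult_left_mono) auto
  then show ?thesis using assms(1) by (simp add: norm_mult)
qed

lemma one_minus_norm_square: "complex_of_real (1 - (norm a)\<^sup>2) = 1 - cnj a * a"
  by (simp only: of_real_diff of_real_1 complex_norm_square mult.commute)

text \<open>The point \<open>x\<close> itself may have a zero of \<open>1 - z x\<^sub>1 - w x\<^sub>2 + z w x\<^sub>3\<close> on the
  boundary of the bidisc; the points \<open>(r x\<^sub>1, r x\<^sub>2, r\<^sup>2 x\<^sub>3)\<close> with \<open>r < 1\<close> have none, as
  passing to them amounts to replacing \<open>z, w\<close> by \<open>r z, r w\<close>.\<close>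

lemma closure_tetrablockI:
  assumes x2: "norm (x $ 2) \<le> 1"
    and x: "\<And>w. norm w < 1 \<Longrightarrow> norm (x $ 1 - w * x $ 3) \<le> norm (1 - w * x $ 2)"
  shows "x \<in> closure tetrablock"
proof -
  define y :: "real \<Rightarrow> complex ^ 3" where
    "y = (\<lambda>r. vector [of_real r * x $ 1, of_real r * x $ 2, of_real r ^ 2 * x $ 3])"
  have "y r \<in> tetrablock" if r: "r \<in> {0<..<1}" for r
    unfolding tetrablock_def mem_Collect_eq
  proof (intro allI impI, elim conjE)
    fix z w :: complex assume z: "norm z \<le> 1" and w: "norm w \<le> 1"
    define z' w' where "z' = of_real r * z" and "w' = of_real r * w"
    have z': "norm z' < 1" and w': "norm w' < 1"
      using r z w norm_mult_less_1[of "of_real r"] by (auto simp: z'_def w'_def)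
    have "norm (w' * x $ 2) < 1"
      using w' x2 by (rule norm_mult_less_1)
    then have pos: "norm (1 - w' * x $ 2) > 0" by auto
    have "norm (z' * (x $ 1 - w' * x $ 3)) \<le> norm z' * norm (1 - w' * x $ 2)"
      using x[OF w'] by (simp add: norm_mult mult_left_mono)
    also have "\<dots> < norm (1 - w' * x $ 2)" using pos z' by simp
    finally have "1 - w' * x $ 2 \<noteq> z' * (x $ 1 - w' * x $ 3)" by auto
    then show "1 - z * y r $ 1 - w * y r $ 2 + z * w * y r $ 3 \<noteq> 0"
      by (simp add: y_def z'_def w'_def algebra_simps power2_eq_square)
  qed
  moreover have "(y \<longlongrightarrow> x) (at_left 1)"
  proof (rule vec_tendstoI)
    have "((\<lambda>r. y r $ 1) \<longlongrightarrow> x $ 1) (at_left 1)" "((\<lambda>r. y r $ 2) \<longlongrightarrow> x $ 2) (at_left 1)"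
      "((\<lambda>r. y r $ 3) \<longlongrightarrow> x $ 3) (at_left 1)"
      unfolding y_def vector_3 by (auto intro!: tendsto_eq_intros)
    then show "((\<lambda>r. y r $ j) \<longlongrightarrow> x $ j) (at_left 1)" for j
      using exhaust_3[of j] by auto
  qed
  moreover have "\<forall>\<^sub>F r in at_left 1. r \<in> {0<..<1::real}"
    using eventually_at_left_real[of 0 1] by simp
  ultimately show ?thesis
    by (intro Lim_in_closed_set[of _ y "at_left 1"])
       (auto elim!: eventually_mono intro: subsetD[OF closure_subset])
qed

lemma norm_sum_aligned_phase:
  fixes a b :: complex
  obtains \<zeta> where "norm \<zeta> = 1" "norm (a + \<zeta> * b) = norm a + norm b"
proof (cases "a = 0 \<or> b = 0")
  case True
  then show ?thesis using that[of 1] by auto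
next
  case False
  define \<zeta> where "\<zeta> = sgn a / sgn b"
  have "a + \<zeta> * b = sgn a * of_real (norm a + norm b)"
    using False by (simp add: \<zeta>_def sgn_eq field_simps)
  then have "norm (a + \<zeta> * b) = norm a + norm b"
    using False by (simp add: norm_mult norm_sgn del: of_real_add)
  moreover have "norm \<zeta> = 1" using False by (simp add: \<zeta>_def norm_divide norm_sgn)
  ultimately show ?thesis using that by blast
qed

text \<open>For \<open>x\<close> in the tetrablock the linear fractional map
  \<open>w \<mapsto> (x\<^sub>1 - w x\<^sub>3) / (1 - w x\<^sub>2)\<close> sends the closed disc into the open disc. It sends the unit
  circle to the circle with centre \<open>(x\<^sub>1 - cnj x\<^sub>2 x\<^sub>3) / (1 - |x\<^sub>2|\<^sup>2)\<close> and radius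
  \<open>|x\<^sub>1 x\<^sub>2 - x\<^sub>3| / (1 - |x\<^sub>2|\<^sup>2)\<close>, and the second estimate says that this circle stays in the
  disc.\<close>

lemma tetrablock_estimate:
  assumes "x \<in> tetrablock"
  shows "norm (x $ 2) < 1"
    and "norm (x $ 1 - cnj (x $ 2) * x $ 3) + norm (x $ 1 * x $ 2 - x $ 3) \<le> 1 - (norm (x $ 2))\<^sup>2"
proof -
  have nz: "1 - z * x $ 1 - w * x $ 2 + z * w * x $ 3 \<noteq> 0" if "norm z \<le> 1" "norm w \<le> 1" for z w
    using assms that by (simp add: tetrablock_def)
  show x2: "norm (x $ 2) < 1"
  proof (rule ccontr)
    assume "\<not> norm (x $ 2) < 1"
    then have "norm (inverse (x $ 2)) \<le> 1" "x $ 2 \<noteq> 0"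
      by (auto simp: norm_inverse inverse_le_1_iff)
    then show False using nz[of 0 "inverse (x $ 2)"] by simp
  qed
  have less: "norm (x $ 1 - w * x $ 3) < norm (1 - w * x $ 2)" if w: "norm w \<le> 1" for w
  proof (rule ccontr)
    assume *: "\<not> norm (x $ 1 - w * x $ 3) < norm (1 - w * x $ 2)"
    have "1 - w * x $ 2 \<noteq> 0" using nz[of 0 w] w by simp
    then have ne: "x $ 1 - w * x $ 3 \<noteq> 0" using * by auto
    have "norm ((1 - w * x $ 2) / (x $ 1 - w * x $ 3)) \<le> 1"
      using * ne by (simp add: norm_divide divide_le_eq)
    from nz[OF this w] show False using ne by (simp add: field_simps)
  qed
  obtain \<zeta> where \<zeta>: "norm \<zeta> = 1"
    "norm ((x $ 1 - cnj (x $ 2) * x $ 3) + \<zeta> * (x $ 1 * x $ 2 - x $ 3))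
      = norm (x $ 1 - cnj (x $ 2) * x $ 3) + norm (x $ 1 * x $ 2 - x $ 3)"
    by (rule norm_sum_aligned_phase)
  \<comment> \<open>A Blaschke reparametrisation of the circle that turns the linear fractional map into
    centre plus \<open>\<zeta>\<close> times radius.\<close>
  define w where "w = (\<zeta> + cnj (x $ 2)) / (1 + x $ 2 * \<zeta>)"
  have "norm (x $ 2 * \<zeta>) < 1" using \<zeta> x2 by (simp add: norm_mult)
  then have ne: "1 + x $ 2 * \<zeta> \<noteq> 0" by (metis add.inverse_inverse add_eq_0_iff norm_minus_cancel norm_one less_irrefl)
  have "\<zeta> + cnj (x $ 2) = \<zeta> * cnj (1 + x $ 2 * \<zeta>)"
    using complex_norm_square[of \<zeta>] \<zeta>(1) by (simp add: algebra_simps)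
  then have "norm (\<zeta> + cnj (x $ 2)) = norm (1 + x $ 2 * \<zeta>)"
    using \<zeta>(1) by (simp only: norm_mult complex_mod_cnj)
  then have "norm w \<le> 1" using ne by (simp add: w_def norm_divide)
  from less[OF this]
  have "norm ((x $ 1 - w * x $ 3) * (1 + x $ 2 * \<zeta>)) < norm ((1 - w * x $ 2) * (1 + x $ 2 * \<zeta>))"
    using ne by (simp add: norm_mult)
  moreover have "(x $ 1 - w * x $ 3) * (1 + x $ 2 * \<zeta>)
      = (x $ 1 - cnj (x $ 2) * x $ 3) + \<zeta> * (x $ 1 * x $ 2 - x $ 3)"
    using ne by (simp add: w_def field_simps)
  moreover have "(1 - w * x $ 2) * (1 + x $ 2 * \<zeta>) = of_real (1 - (norm (x $ 2))\<^sup>2)"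
    unfolding one_minus_norm_square using ne by (simp add: w_def field_simps)
  moreover have "norm (complex_of_real (1 - (norm (x $ 2))\<^sup>2)) = 1 - (norm (x $ 2))\<^sup>2"
    using x2 unfolding norm_of_real by (simp add: power_le_one_iff)
  ultimately show "norm (x $ 1 - cnj (x $ 2) * x $ 3) + norm (x $ 1 * x $ 2 - x $ 3) \<le> 1 - (norm (x $ 2))\<^sup>2"
    using \<zeta>(2) by simp
qed

lemma closure_tetrablock_estimate:
  assumes "x \<in> closure tetrablock"
  shows "norm (x $ 1 - cnj (x $ 2) * x $ 3) + norm (x $ 1 * x $ 2 - x $ 3) \<le> 1 - (norm (x $ 2))\<^sup>2"
proof -
  let ?S = "{x :: complex ^ 3. norm (x $ 1 - cnj (x $ 2) * x $ 3) + norm (x $ 1 * x $ 2 - x $ 3) \<le> 1 - (norm (x $ 2))\<^sup>2}"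
  have "closed ?S" by (intro closed_Collect_le continuous_intros)
  moreover have "tetrablock \<subseteq> ?S" using tetrablock_estimate(2) by blast
  ultimately show ?thesis using assms closure_minimal by blast
qed

lemma closure_tetrablock_norm_2:
  assumes "x \<in> closure tetrablock"
  shows "norm (x $ 2) \<le> 1"
proof -
  have "0 \<le> 1 - (norm (x $ 2))\<^sup>2"
    using closure_tetrablock_estimate[OF assms] by (meson add_nonneg_nonneg norm_ge_zero order_trans)
  then show ?thesis by (simp add: power_le_one_iff)
qed

section \<open>Peak functions on the closed tetrablock\<close>

text \<open>The distinguished boundary of the tetrablock in explicit form.\<close>

definition tetrablock_boundary :: "(complex ^ 3) set"
  where "tetrablock_boundary =
    {x. x $ 1 = cnj (x $ 2) * x $ 3 \<and> norm (x $ 2) \<le> 1 \<and> norm (x $ 3) = 1}"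

lemma blaschke_identity:
  "(norm (1 - cnj a * b))\<^sup>2 = (norm (a - b))\<^sup>2 + (1 - (norm a)\<^sup>2) * (1 - (norm b)\<^sup>2)"
proof -
  have "complex_of_real ((norm (1 - cnj a * b))\<^sup>2) =
      complex_of_real ((norm (a - b))\<^sup>2 + (1 - (norm a)\<^sup>2) * (1 - (norm b)\<^sup>2))"
    unfolding of_real_add of_real_mult of_real_diff of_real_1 complex_norm_square
    by (simp add: algebra_simps)
  then show ?thesis using of_real_eq_iff by blast
qed

lemma tetrablock_boundary_estimate:
  assumes "x \<in> tetrablock_boundary" "norm w \<le> 1"
  shows "norm (x $ 1 - w * x $ 3) \<le> norm (1 - w * x $ 2)"
proof -
  have x: "x $ 1 = cnj (x $ 2) * x $ 3" "norm (x $ 2) \<le> 1" "norm (x $ 3) = 1"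
    using assms by (auto simp: tetrablock_boundary_def)
  have "norm (x $ 1 - w * x $ 3) = norm (cnj (x $ 2) - w)"
    using x by (metis left_diff_distrib mult.right_neutral norm_mult)
  also have "\<dots> \<le> norm (1 - w * x $ 2)"
  proof (rule power2_le_imp_le)
    have "0 \<le> (1 - (norm (x $ 2))\<^sup>2) * (1 - (norm w)\<^sup>2)"
      using x(2) assms(2) by (intro mult_nonneg_nonneg) (auto simp: power_le_one_iff)
    then show "(norm (cnj (x $ 2) - w))\<^sup>2 \<le> (norm (1 - w * x $ 2))\<^sup>2"
      using blaschke_identity[of "cnj (x $ 2)" w] by (simp add: mult.commute)
  qed simp
  finally show ?thesis .
qed

lemma tetrablock_boundary_subset: "tetrablock_boundary \<subseteq> closure tetrablock"
  using closure_tetrablockI tetrablock_boundary_estimate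
  by (force simp: tetrablock_boundary_def[abs_def])

lemma holomorphic_several_coord: "holomorphic_several_on (\<lambda>x. x $ j) U"
  unfolding holomorphic_several_on_def
  by (intro ballI exI[of _ "\<lambda>v. v $ j"]) (auto intro!: bounded_linear_imp_has_derivative bounded_linear_vec_nth)

lemma holomorphic_several_const: "holomorphic_several_on (\<lambda>x. c) U"
  unfolding holomorphic_several_on_def by (intro ballI exI[of _ "\<lambda>v. 0"]) auto

lemma holomorphic_several_add:
  assumes "holomorphic_several_on f U" "holomorphic_several_on g U"
  shows "holomorphic_several_on (\<lambda>x. f x + g x) U"
  unfolding holomorphic_several_on_def
proof
  fix x assume "x \<in> U"
  then obtain L M where "(f has_derivative L) (at x)" "\<forall>c v. L (c *s v) = c * L v"
      "(g has_derivative M) (at x)" "\<forall>c v. M (c *s v) = c * M v"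
    using assms unfolding holomorphic_several_on_def by blast
  then show "\<exists>L. ((\<lambda>x. f x + g x) has_derivative L) (at x) \<and> (\<forall>c v. L (c *s v) = c * L v)"
    by (intro exI[of _ "\<lambda>v. L v + M v"] conjI has_derivative_add) (auto simp: algebra_simps)
qed

lemma holomorphic_several_diff:
  assumes "holomorphic_several_on f U" "holomorphic_several_on g U"
  shows "holomorphic_several_on (\<lambda>x. f x - g x) U"
  unfolding holomorphic_several_on_def
proof
  fix x assume "x \<in> U"
  then obtain L M where "(f has_derivative L) (at x)" "\<forall>c v. L (c *s v) = c * L v"
      "(g has_derivative M) (at x)" "\<forall>c v. M (c *s v) = c * M v"
    using assms unfolding holomorphic_several_on_def by blast
  then show "\<exists>L. ((\<lambda>x. f x - g x) has_derivative L) (at x) \<and> (\<forall>c v. L (c *s v) = c * L v)"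
    by (intro exI[of _ "\<lambda>v. L v - M v"] conjI has_derivative_diff) (auto simp: algebra_simps)
qed

lemma holomorphic_several_mult:
  assumes "holomorphic_several_on f U" "holomorphic_several_on g U"
  shows "holomorphic_several_on (\<lambda>x. f x * g x) U"
  unfolding holomorphic_several_on_def
proof
  fix x assume "x \<in> U"
  then obtain L M where "(f has_derivative L) (at x)" "\<forall>c v. L (c *s v) = c * L v"
      "(g has_derivative M) (at x)" "\<forall>c v. M (c *s v) = c * M v"
    using assms unfolding holomorphic_several_on_def by blast
  then show "\<exists>L. ((\<lambda>x. f x * g x) has_derivative L) (at x) \<and> (\<forall>c v. L (c *s v) = c * L v)"
    by (intro exI[of _ "\<lambda>v. f x * M v + L v * g x"] conjI has_derivative_mult) (auto simp: algebra_simps)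
qed

lemma holomorphic_several_inverse:
  assumes "holomorphic_several_on f U" "\<And>x. x \<in> U \<Longrightarrow> f x \<noteq> 0"
  shows "holomorphic_several_on (\<lambda>x. inverse (f x)) U"
  unfolding holomorphic_several_on_def
proof
  fix x assume x: "x \<in> U"
  then obtain L where "(f has_derivative L) (at x)" "\<forall>c v. L (c *s v) = c * L v"
    using assms unfolding holomorphic_several_on_def by blast
  then show "\<exists>L. ((\<lambda>x. inverse (f x)) has_derivative L) (at x) \<and> (\<forall>c v. L (c *s v) = c * L v)"
    using assms(2)[OF x]
    by (intro exI[of _ "\<lambda>v. - (inverse (f x) * L v * inverse (f x))"] conjI Deriv.has_derivative_inverse)
       (auto simp: algebra_simps)
qed

lemma holomorphic_several_imp_continuous_on:
  "holomorphic_several_on f U \<Longrightarrow> continuous_on U f"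
  unfolding holomorphic_several_on_def
  by (meson continuous_at_imp_continuous_on has_derivative_continuous)

lemma holomorphic_several_on_subset:
  "holomorphic_several_on f U \<Longrightarrow> V \<subseteq> U \<Longrightarrow> holomorphic_several_on f V"
  unfolding holomorphic_several_on_def by blast

lemma peak_point_in_shilov_boundary:
  assumes f: "f \<in> disc_algebra K" and p: "p \<in> K"
    and peak: "\<And>x. x \<in> K \<Longrightarrow> norm (f p) \<le> norm (f x) \<Longrightarrow> x = p"
  shows "p \<in> shilov_boundary K"
  unfolding shilov_boundary_def
proof
  fix C assume "C \<in> {C. max_modulus_set K C}"
  then obtain x where "x \<in> C" "x \<in> K" "norm (f p) \<le> norm (f x)"
    using f p unfolding max_modulus_set_def by blast
  then show "p \<in> C" using peak by blast
qed

lemma closed_shilov_boundary: "closed (shilov_boundary K)"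
  unfolding shilov_boundary_def by (rule closed_Inter) (auto simp: max_modulus_set_def)

lemma one_plus_unimodular_eq:
  assumes "norm (h :: complex) \<le> 1" "2 \<le> norm (1 + h)"
  shows "h = 1"
proof -
  have "(norm (1 + h))\<^sup>2 = 1 + 2 * Re h + (norm h)\<^sup>2"
    unfolding cmod_power2 by (simp add: power2_eq_square algebra_simps)
  moreover have "2\<^sup>2 \<le> (norm (1 + h))\<^sup>2" using assms(2) by (intro power_mono) auto
  moreover have h: "(norm h)\<^sup>2 \<le> 1" using assms(1) by (simp add: power_le_one_iff)
  ultimately have "1 \<le> Re h" by simp
  moreover have "(Re h)\<^sup>2 + (Im h)\<^sup>2 \<le> 1" using h by (simp add: cmod_power2)
  moreover have "1 \<le> (Re h)\<^sup>2" using \<open>1 \<le> Re h\<close> by (simp add: one_le_power)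
  ultimately have "(Im h)\<^sup>2 \<le> 0" "(Re h)\<^sup>2 \<le> 1"
    using zero_le_power2[of "Im h"] by linarith+
  then have "Im h = 0" "Re h = 1" using \<open>1 \<le> Re h\<close> abs_square_le_1[of "Re h"] by simp_all
  then show ?thesis using \<open>Im h = 0\<close> by (simp add: complex_eq_iff)
qed

text \<open>At \<open>(0, 0, 1)\<close> the function \<open>1 + x\<^sub>3 - x\<^sub>1 x\<^sub>2\<close> peaks, since
  \<open>|x\<^sub>3 - x\<^sub>1 x\<^sub>2| \<le> 1 - |x\<^sub>2|\<^sup>2\<close> on the closed tetrablock. The function below is the composition of
  \<open>x\<^sub>3 - x\<^sub>1 x\<^sub>2\<close> with the automorphism
  \<open>x \<mapsto> (x\<^sub>1 - cnj a x\<^sub>3, x\<^sub>2 - a, x\<^sub>3 - a x\<^sub>1) / (1 - cnj a x\<^sub>2)\<close> of the tetrablock, which moves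
  \<open>(cnj a, a, 1)\<close> to \<open>(0, 0, 1)\<close>. The square of the inverse is spelled out as a product so that
  closure of holomorphic functions under products applies directly.\<close>

definition tetrablock_peak :: "complex \<Rightarrow> complex ^ 3 \<Rightarrow> complex"
  where "tetrablock_peak a x =
    of_real (1 - (norm a)\<^sup>2) * ((x $ 3 - x $ 1 * x $ 2) * (inverse (1 - cnj a * x $ 2) * inverse (1 - cnj a * x $ 2)))"

lemma tetrablock_peak_at_boundary:
  assumes "norm a < 1" "x $ 2 = a" "x $ 1 = cnj a * x $ 3"
  shows "tetrablock_peak a x = x $ 3"
proof -
  define d where "d = 1 - cnj a * a"
  have "d \<noteq> 0" using norm_mult_less_1[of "cnj a" a] assms(1) by (auto simp: d_def)
  then have "d * (c * d * (inverse d * inverse d)) = c" for c by (simp add: field_simps)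
  moreover have "x $ 3 - x $ 1 * x $ 2 = x $ 3 * d" by (simp add: assms d_def algebra_simps)
  ultimately show ?thesis
    unfolding tetrablock_peak_def one_minus_norm_square assms(2) d_def[symmetric]
    by simp
qed

text \<open>By the Blaschke identity, \<open>(1 - |a|\<^sup>2) (1 - |x\<^sub>2|\<^sup>2)\<close> equals
  \<open>|1 - cnj a x\<^sub>2|\<^sup>2 - |a - x\<^sub>2|\<^sup>2\<close>. Multiplying the estimate for the closed tetrablock by
  \<open>1 - |a|\<^sup>2\<close> therefore bounds the peak function by \<open>1\<close>, with nonnegative error terms whose
  vanishing forces \<open>x\<^sub>2 = a\<close> and \<open>x\<^sub>1 = cnj a x\<^sub>3\<close>.\<close>

lemma tetrablock_peak_le:
  assumes a: "norm a < 1" and x: "x \<in> closure tetrablock"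
  shows "norm (tetrablock_peak a x) \<le> 1"
    and "norm (tetrablock_peak a x) = 1 \<Longrightarrow> x $ 2 = a \<and> x $ 1 = cnj a * x $ 3 \<and> tetrablock_peak a x = x $ 3"
proof -
  define D where "D = (norm (1 - cnj a * x $ 2))\<^sup>2"
  have x2: "norm (x $ 2) \<le> 1" by (rule closure_tetrablock_norm_2[OF x])
  have a1: "1 - (norm a)\<^sup>2 > 0" using a by (simp add: power_less_one_iff)
  have "norm (cnj a * x $ 2) < 1"
    using a x2 by (intro norm_mult_less_1) auto
  then have D: "D > 0" by (auto simp: D_def)
  have norm_eq: "norm (tetrablock_peak a x) = (1 - (norm a)\<^sup>2) * norm (x $ 1 * x $ 2 - x $ 3) / D"
    unfolding tetrablock_peak_def norm_mult norm_inverse norm_of_real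
    using a1 by (simp add: D_def power2_eq_square norm_minus_commute field_simps)
  have est: "norm (x $ 1 - cnj (x $ 2) * x $ 3) + norm (x $ 1 * x $ 2 - x $ 3) \<le> 1 - (norm (x $ 2))\<^sup>2"
    by (rule closure_tetrablock_estimate[OF x])
  then have "(1 - (norm a)\<^sup>2) * (norm (x $ 1 - cnj (x $ 2) * x $ 3) + norm (x $ 1 * x $ 2 - x $ 3))
      \<le> (1 - (norm a)\<^sup>2) * (1 - (norm (x $ 2))\<^sup>2)"
    using a1 by (intro mult_left_mono) auto
  also have "\<dots> = D - (norm (a - x $ 2))\<^sup>2"
    using blaschke_identity[of a "x $ 2"] by (simp add: D_def)
  finally have key: "(1 - (norm a)\<^sup>2) * norm (x $ 1 - cnj (x $ 2) * x $ 3) + (norm (a - x $ 2))\<^sup>2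
      + (1 - (norm a)\<^sup>2) * norm (x $ 1 * x $ 2 - x $ 3) \<le> D"
    by (simp add: algebra_simps)
  have nn: "0 \<le> (1 - (norm a)\<^sup>2) * norm (x $ 1 - cnj (x $ 2) * x $ 3)" "0 \<le> (norm (a - x $ 2))\<^sup>2"
    using a1 by auto
  show "norm (tetrablock_peak a x) \<le> 1"
  proof -
    have "(1 - (norm a)\<^sup>2) * norm (x $ 1 * x $ 2 - x $ 3) \<le> D" using key nn by linarith
    then show ?thesis unfolding norm_eq using D by (simp add: divide_le_eq)
  qed
  assume "norm (tetrablock_peak a x) = 1"
  then have "(1 - (norm a)\<^sup>2) * norm (x $ 1 * x $ 2 - x $ 3) = D"
    unfolding norm_eq using D by (simp add: divide_eq_eq)
  then have "(1 - (norm a)\<^sup>2) * norm (x $ 1 - cnj (x $ 2) * x $ 3) = 0" "(norm (a - x $ 2))\<^sup>2 = 0"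
    using key nn by linarith+
  then have eqs: "x $ 2 = a" "x $ 1 = cnj a * x $ 3" using a1 by auto
  moreover have "tetrablock_peak a x = x $ 3" by (rule tetrablock_peak_at_boundary[OF a eqs])
  ultimately show "x $ 2 = a \<and> x $ 1 = cnj a * x $ 3 \<and> tetrablock_peak a x = x $ 3"
    by simp
qed

text \<open>The peak function has modulus \<open>1\<close> at all points \<open>(cnj a \<omega>, a, \<omega>)\<close> with \<open>|\<omega>| = 1\<close>;
  rotating its value at one of them to \<open>1\<close> and adding \<open>1\<close> singles this point out.\<close>

lemma tetrablock_boundary_point_in_shilov:
  assumes p: "p \<in> tetrablock_boundary" and a: "norm (p $ 2) < 1"
  shows "p \<in> shilov_boundary (closure tetrablock)"
proof (rule peak_point_in_shilov_boundary)
  let ?g = "\<lambda>x. 1 + cnj (p $ 3) * tetrablock_peak (p $ 2) x"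
  have p': "p $ 1 = cnj (p $ 2) * p $ 3" "norm (p $ 3) = 1"
    using p by (auto simp: tetrablock_boundary_def)
  have one: "cnj (p $ 3) * p $ 3 = 1" using p'(2) complex_norm_square[of "p $ 3"] by (simp add: mult.commute)
  have hol: "holomorphic_several_on ?g (closure tetrablock)"
  proof -
    have "1 - cnj (p $ 2) * x $ 2 \<noteq> 0" if "x \<in> closure tetrablock" for x
    proof -
      have "norm (cnj (p $ 2) * x $ 2) < 1"
        using a closure_tetrablock_norm_2[OF that] by (intro norm_mult_less_1) auto
      then show ?thesis by auto
    qed
    then show ?thesis
      unfolding tetrablock_peak_def
      by (intro holomorphic_several_add holomorphic_several_diff holomorphic_several_mult holomorphic_several_inverse
          holomorphic_several_coord holomorphic_several_const)
  qed
  show "?g \<in> disc_algebra (closure tetrablock)"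
    unfolding disc_algebra_def
    using holomorphic_several_imp_continuous_on[OF hol]
      holomorphic_several_on_subset[OF hol interior_subset] by simp
  show "p \<in> closure tetrablock" using p tetrablock_boundary_subset by blast
  have "tetrablock_peak (p $ 2) p = p $ 3"
    using tetrablock_peak_at_boundary[OF a] p' by simp
  then have "?g p = 2" using one by simp
  fix x assume x: "x \<in> closure tetrablock" and "norm (?g p) \<le> norm (?g x)"
  then have "2 \<le> norm (1 + cnj (p $ 3) * tetrablock_peak (p $ 2) x)"
    using \<open>?g p = 2\<close> by simp
  moreover have "norm (cnj (p $ 3) * tetrablock_peak (p $ 2) x) \<le> 1"
    using tetrablock_peak_le(1)[OF a x] p' by (simp add: norm_mult)
  ultimately have eq: "cnj (p $ 3) * tetrablock_peak (p $ 2) x = 1"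
    by (intro one_plus_unimodular_eq)
  then have "norm (tetrablock_peak (p $ 2) x) = 1"
    using p'(2) by (metis complex_mod_cnj mult_1 norm_mult norm_one)
  from tetrablock_peak_le(2)[OF a x this]
  have x': "x $ 2 = p $ 2" "x $ 1 = cnj (p $ 2) * x $ 3" "tetrablock_peak (p $ 2) x = x $ 3" by auto
  moreover have "x $ 3 = p $ 3"
    using eq one x'(3) by (metis mult_cancel_left mult_zero_left zero_neq_one)
  ultimately show "x = p" using p' by (simp add: vec_eq_iff forall_3)
qed

text \<open>Points with \<open>|x\<^sub>2| = 1\<close> are limits of points \<open>(r x\<^sub>1, r x\<^sub>2, x\<^sub>3)\<close> with \<open>r < 1\<close>, and
  the Shilov boundary is closed.\<close>

theorem tetrablock_boundary_subset_shilov: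
  "tetrablock_boundary \<subseteq> shilov_boundary (closure tetrablock)"
proof
  fix p assume p: "p \<in> tetrablock_boundary"
  define y :: "real \<Rightarrow> complex ^ 3" where
    "y = (\<lambda>r. vector [of_real r * p $ 1, of_real r * p $ 2, p $ 3])"
  have "y r \<in> shilov_boundary (closure tetrablock)" if r: "r \<in> {0<..<1}" for r
  proof (rule tetrablock_boundary_point_in_shilov)
    have "norm (of_real r * p $ 2) < 1"
      using r p by (intro norm_mult_less_1) (auto simp: tetrablock_boundary_def)
    then show "norm (y r $ 2) < 1" "y r \<in> tetrablock_boundary"
      using p by (auto simp: y_def tetrablock_boundary_def)
  qed
  moreover have "(y \<longlongrightarrow> p) (at_left 1)"
  proof (rule vec_tendstoI)
    have "((\<lambda>r. y r $ 1) \<longlongrightarrow> p $ 1) (at_left 1)" "((\<lambda>r. y r $ 2) \<longlongrightarrow> p $ 2) (at_left 1)"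
      "((\<lambda>r. y r $ 3) \<longlongrightarrow> p $ 3) (at_left 1)"
      unfolding y_def vector_3 by (auto intro!: tendsto_eq_intros)
    then show "((\<lambda>r. y r $ j) \<longlongrightarrow> p $ j) (at_left 1)" for j
      using exhaust_3[of j] by auto
  qed
  moreover have "\<forall>\<^sub>F r in at_left 1. r \<in> {0<..<1::real}"
    using eventually_at_left_real[of 0 1] by simp
  ultimately show "p \<in> shilov_boundary (closure tetrablock)"
    by (intro Lim_in_closed_set[of _ y "at_left 1"])
       (auto elim: eventually_mono intro: closed_shilov_boundary)
qed

section \<open>Symmetrised points in the closed tetrablock\<close>

definition sym_point :: "nat \<Rightarrow> complex ^ 'n \<Rightarrow> complex ^ 3"
  where "sym_point i w = vector
    [elem_sym i w / of_nat (CARD('n) choose i),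
     elem_sym (CARD('n) - i) w / of_nat (CARD('n) choose i),
     \<Prod>j\<in>UNIV. w $ j]"

lemma sym_point_nth [simp]:
  fixes w :: "complex ^ 'n"
  shows "sym_point i w $ 1 = elem_sym i w / of_nat (CARD('n) choose i)"
    "sym_point i w $ 2 = elem_sym (CARD('n) - i) w / of_nat (CARD('n) choose i)"
    "sym_point i w $ 3 = (\<Prod>j\<in>UNIV. w $ j)"
  by (simp_all add: sym_point_def)

text \<open>The binomial coefficient is the number of terms of \<open>elem_sym (n - i)\<close>, which is the same as
  for \<open>i\<close>.\<close>

lemma norm_sym_point_2:
  fixes w :: "complex ^ 'n::finite"
  assumes "w \<in> closed_polydisc" "i \<le> CARD('n)"
  shows "norm (sym_point i w $ 2) \<le> 1"
proof -
  have "norm (elem_sym (CARD('n) - i) w) \<le> real (CARD('n) choose i)"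
    using norm_elem_sym_le[of w "CARD('n) - i"] assms binomial_symmetric[OF assms(2)]
    by (simp add: closed_polydisc_def)
  then show ?thesis using assms(2) by (simp add: norm_divide divide_le_eq zero_less_binomial)
qed

lemma sym_point_torus:
  fixes w :: "complex ^ 'n::finite"
  assumes w: "w \<in> torus" and i: "i \<le> CARD('n)"
  shows "sym_point i w \<in> tetrablock_boundary"
proof -
  have "norm (w $ j) = 1" for j using w by (simp add: torus_def)
  then have "elem_sym i w = cnj (elem_sym (CARD('n) - i) w) * (\<Prod>j\<in>UNIV. w $ j)"
    and "norm (\<Prod>j\<in>UNIV. w $ j) = 1"
    using elem_sym_reflect_torus[of w i] i by (simp_all add: prod_norm[symmetric])
  moreover have "norm (sym_point i w $ 2) \<le> 1"
    using w i torus_subset_closed_polydisc by (intro norm_sym_point_2) auto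
  ultimately show ?thesis by (simp add: tetrablock_boundary_def)
qed

text \<open>For \<open>|t| < 1\<close> the quotient \<open>(x\<^sub>1 - t x\<^sub>3) / (1 - t x\<^sub>2)\<close> with \<open>x = sym_point i w\<close> is a
  holomorphic function of \<open>w\<close> in the polydisc. On the torus it is bounded by \<open>1\<close>, because there
  \<open>x\<close> lies in \<open>tetrablock_boundary\<close>. The maximum principle carries the bound to the whole
  polydisc, where it implies membership in the closed tetrablock.\<close>

theorem sym_point_closed_polydisc:
  fixes w :: "complex ^ 'n::finite"
  assumes w: "w \<in> closed_polydisc" and i: "i \<le> CARD('n)"
  shows "sym_point i w \<in> closure tetrablock"
proof (rule closure_tetrablockI)
  show "norm (sym_point i w $ 2) \<le> 1" by (rule norm_sym_point_2[OF w i])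
  fix t :: complex assume t: "norm t < 1"
  let ?g = "\<lambda>v :: complex ^ 'n. (sym_point i v $ 1 - t * sym_point i v $ 3) / (1 - t * sym_point i v $ 2)"
  have nz: "1 - t * sym_point i v $ 2 \<noteq> 0" if "v \<in> closed_polydisc" for v :: "complex ^ 'n"
    using norm_mult_less_1[OF t norm_sym_point_2[OF that i]] by auto
  have upd: "upd v l s \<in> closed_polydisc" if "v \<in> polydisc" "s \<in> ball 0 1" for v :: "complex ^ 'n" and l s
    using that by (auto simp: polydisc_def closed_polydisc_def less_imp_le)
  have "continuous_on closed_polydisc ?g"
    by (intro continuous_on_divide continuous_on_diff continuous_on_mult continuous_on_const)
       (use nz i in \<open>auto intro!: continuous_intros\<close>)
  moreover have "(\<lambda>s. ?g (upd v l s)) holomorphic_on ball 0 1" if "v \<in> polydisc" for v l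
    using nz[OF upd[OF that]] unfolding sym_point_nth
    by (intro holomorphic_on_divide holomorphic_on_diff holomorphic_on_mult holomorphic_on_const
        holomorphic_elem_sym holomorphic_on_prod holomorphic_upd_nth) (use i in auto)
  ultimately obtain u where u: "u \<in> torus" "norm (?g w) \<le> norm (?g u)"
    using polydisc_maximum_modulus[of ?g] w by blast
  have "norm (?g u) \<le> 1"
    using tetrablock_boundary_estimate[OF sym_point_torus[OF u(1) i], of t] t
    by (simp add: norm_divide divide_le_eq_1 del: sym_point_nth)
  with u(2) have "norm (?g w) \<le> 1" by linarith
  moreover have "norm (1 - t * sym_point i w $ 2) > 0" using nz[OF w] by simp
  ultimately show "norm (sym_point i w $ 1 - t * sym_point i w $ 3) \<le> norm (1 - t * sym_point i w $ 2)"
    unfolding norm_divide by (simp only: pos_divide_le_eq mult_1)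
qed

section \<open>Inner functions\<close>

context theta_map
begin

definition theta_to_tetrablock :: "nat \<Rightarrow> complex ^ 'n \<Rightarrow> complex ^ 3"
  where "theta_to_tetrablock i y = vector
    [y $ e i / of_nat (CARD('n) choose i), y $ e (CARD('n) - i) / of_nat (CARD('n) choose i),
     (y $ e CARD('n)) ^ p]"

lemma theta_to_tetrablock_theta:
  assumes "1 \<le> i" "i < CARD('n)"
  shows "theta_to_tetrablock i (theta e m p z) = sym_point i (coord_power m z)"
  using assms theta_last_power[of z]
  by (simp add: theta_to_tetrablock_def sym_point_def theta_nth)

lemma tendsto_theta_to_tetrablock:
  assumes "(f \<longlongrightarrow> l) F"
  shows "((\<lambda>x. theta_to_tetrablock i (f x)) \<longlongrightarrow> theta_to_tetrablock i l) F"
proof (rule vec_tendstoI)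
  have *: "((\<lambda>x. f x $ j) \<longlongrightarrow> l $ j) F" for j by (rule tendsto_vec_nth[OF assms])
  have "((\<lambda>x. theta_to_tetrablock i (f x) $ 1) \<longlongrightarrow> theta_to_tetrablock i l $ 1) F"
    "((\<lambda>x. theta_to_tetrablock i (f x) $ 2) \<longlongrightarrow> theta_to_tetrablock i l $ 2) F"
    "((\<lambda>x. theta_to_tetrablock i (f x) $ 3) \<longlongrightarrow> theta_to_tetrablock i l $ 3) F"
    unfolding theta_to_tetrablock_def vector_3 divide_inverse
    by (intro tendsto_mult tendsto_power tendsto_const *)+
  then show "((\<lambda>x. theta_to_tetrablock i (f x) $ j) \<longlongrightarrow> theta_to_tetrablock i l $ j) F" for j
    using exhaust_3[of j] by auto
qed

lemma coord_power_closed_polydisc: "z \<in> closed_polydisc \<Longrightarrow> coord_power m z \<in> closed_polydisc"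
  by (auto simp: closed_polydisc_def norm_power power_le_one)

lemma coord_power_torus: "z \<in> torus \<Longrightarrow> coord_power m z \<in> torus"
  by (auto simp: torus_def norm_power)

lemma theta_to_tetrablock_inner:
  assumes \<Theta>: "Theta_inner e m p \<Theta>" and i: "1 \<le> i" "i < CARD('n)"
  shows "E_inner (\<lambda>z. theta_to_tetrablock i (\<Theta> z))"
  unfolding E_inner_def inner_function_def
proof (intro conjI)
  have hol: "\<And>j. (\<lambda>z. \<Theta> z $ j) holomorphic_on ball 0 1"
    and img: "\<Theta> ` ball 0 1 \<subseteq> closed_Theta e m p"
    and lim: "AE t in lebesgue_on {0..2 * pi}.
       \<exists>l\<in>shilov_boundary (closed_Theta e m p). ((\<lambda>r. \<Theta> (of_real r * cis t)) \<longlongrightarrow> l) (at_left 1)"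
    using \<Theta> by (auto simp: Theta_inner_def inner_function_def)
  have "(CARD('n) choose i) \<noteq> 0" using i by simp
  then show "\<forall>j. (\<lambda>z. theta_to_tetrablock i (\<Theta> z) $ j) holomorphic_on ball 0 1"
    unfolding forall_3 theta_to_tetrablock_def vector_3
    by (intro conjI holomorphic_intros hol) auto
  show "(\<lambda>z. theta_to_tetrablock i (\<Theta> z)) ` ball 0 1 \<subseteq> closure tetrablock"
  proof (intro image_subsetI)
    fix z :: complex assume "z \<in> ball 0 1"
    then have "\<Theta> z \<in> theta e m p ` closed_polydisc"
      using img unfolding closed_Theta_def closed_polydisc_def by blast
    then obtain \<zeta> where "\<zeta> \<in> closed_polydisc" "\<Theta> z = theta e m p \<zeta>" by blast
    then show "theta_to_tetrablock i (\<Theta> z) \<in> closure tetrablock"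
      using i by (simp add: theta_to_tetrablock_theta sym_point_closed_polydisc coord_power_closed_polydisc)
  qed
  show "AE t in lebesgue_on {0..2 * pi}. \<exists>l\<in>shilov_boundary (closure tetrablock).
      ((\<lambda>r. theta_to_tetrablock i (\<Theta> (of_real r * cis t))) \<longlongrightarrow> l) (at_left 1)"
    using lim
  proof (rule eventually_mono)
    fix t
    assume "\<exists>l\<in>shilov_boundary (closed_Theta e m p). ((\<lambda>r. \<Theta> (of_real r * cis t)) \<longlongrightarrow> l) (at_left 1)"
    then obtain u where u: "u \<in> torus" "((\<lambda>r. \<Theta> (of_real r * cis t)) \<longlongrightarrow> theta e m p u) (at_left 1)"
      using shilov_boundary_closed_Theta by blast
    have "theta_to_tetrablock i (theta e m p u) \<in> shilov_boundary (closure tetrablock)"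
      using i u(1) tetrablock_boundary_subset_shilov
        sym_point_torus[OF coord_power_torus[OF u(1)], of i]
      by (auto simp: theta_to_tetrablock_theta)
    then show "\<exists>l\<in>shilov_boundary (closure tetrablock).
      ((\<lambda>r. theta_to_tetrablock i (\<Theta> (of_real r * cis t))) \<longlongrightarrow> l) (at_left 1)"
      using tendsto_theta_to_tetrablock[OF u(2)] by blast
  qed
qed

end

lemma binomial_eq_reflected_sum:
  assumes "1 \<le> i" "i \<le> n - 1"
  shows "((n - 1) choose i) + ((n - 1) choose (n - i)) = n choose i"
proof -
  have "(n - 1) choose (n - i) = (n - 1) choose (i - 1)"
    using binomial_symmetric[of "i - 1" "n - 1"] assms by simp
  then show ?thesis using choose_reduce_nat[of n i] assms by simp
qed

theorem proposition4p7:
  fixes e :: "nat \<Rightarrow> 'n::finite"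
    and m p n i :: nat
    and \<Theta> :: "complex \<Rightarrow> complex ^ 'n"
    and k :: "nat \<Rightarrow> nat"
  assumes "m > 0" and "p > 0" and "p dvd m"
    and "n = CARD('n)" and "n \<ge> 2"
    and "bij_betw e {1..n} UNIV"
    and "\<And>j. k j = ((n - 1) choose j) + ((n - 1) choose (n - j))"
    and "Theta_inner e m p \<Theta>"
    and "1 \<le> i" and "i \<le> n - 1"
  shows "E_inner (\<lambda>z. vector [\<Theta> z $ e i / of_nat (k i),
                              \<Theta> z $ e (n - i) / of_nat (k i),
                              (\<Theta> z $ e n) ^ p])"
proof -
  interpret theta_map e m p
    using assms by unfold_locales simp_all
  have "k i = CARD('n) choose i"
    using binomial_eq_reflected_sum[of i n] assms by simp
  then show ?thesis
    using theta_to_tetrablock_inner[of \<Theta> i] assms by (simp add: theta_to_tetrablock_def)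
qed

end
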